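(* Let Assumptions 1-4 of the context hold, let $\gamma>0$ satisfy $$\gamma<\frac{1}{\max_i\max_{x\in X}\max_{\mu\in M}\sum_{j=1}^n|H_{ij}(x,\mu)|},$$ and set $q_p=1-\gamma\beta$. Fix $\mu(t)\in M$ and let the primal agents asynchronously execute the gradient update law $f(x)=\Pi_X[x-\gamma\nabla_xL_\delta(x,\mu(t))]$ as described in the context. Then for every primal agent $i$ and every time $k$, $$\|x^i(k)-x^*(t)\|_{max}\le q_p^{\mathrm{ops}(k,t)}\max_j\|x^j(0)-x^*(t)\|_{max},$$ where $x^*(t)$ is the fixed point of $f$ for the fixed $\mu(t)$.
   Context: Data: $h:\mathbb{R}^n\to\mathbb{R}$, $g:\mathbb{R}^n\to\mathbb{R}^m$, $X\subset\mathbb{R}^n$, $\delta>0$, $\beta>0$. The regularized Lagrangian is $L_\delta(x,\mu)=h(x)+\mu^Tg(x)-\frac{\delta}{2}\|\mu\|^2$ (Euclidean norm), with Hessian $H(x,\mu)=\nabla_x^2L_\delta(x,\mu)$. Assumption 1: $h$ is twice continuously differentiable and convex. Assumption 2: there is $\bar{x}\in X$ with $g(\bar{x})<0$ componentwise (a Slater point), and each $g_j$ is twice continuously differentiable and convex. Assumption 3: $X$ is non-empty, compact and convex, and $X=X_1\times\cdots\times X_n$ with scalar blocks $X_i\subset\mathbb{R}$. Assumption 4 ($\beta$-diagonal dominance): $|H_{ii}(x,\mu)|-\beta\ge\sum_{j\ne i}|H_{ij}(x,\mu)|$ for all $i\in\{1,\dots,n\}$, for all $x\in X$, $\mu\in\mathbb{R}^m_+$.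 With $\bar{x}$ a Slater point and $h^*:=\min_{x\in X}h(x)$, $M:=\{\mu\in\mathbb{R}^m_+:\|\mu\|_1\le\frac{h(\bar{x})-h^*}{\min_{1\le j\le m}-g_j(\bar{x})}\}$. $\Pi_S$ is Euclidean projection onto $S$; $\|v\|_{max}=\max_i|v_i|$, the maximum being over all components of $v\in\mathbb{R}^n$. Asynchronous execution. There are primal agents $i\in[N_p]=\{1,\dots,n\}$; agent $i$ is the only one that updates the scalar $x_i$. Agent $i$ stores a local vector $x^i(k)\in X$ (also written $x^i(k;t)$), $k=0,1,2,\dots$, whose entry $x^i_j(k)$ is its copy of $x_j$, $j=1,\dots,n$. Time $0$ is the time at which $\mu(t)$ comes onboard, and $x^i(0)\in X$. Agent $j$ is an essential neighbor of $i$ ($j\in\mathcal{N}_i$, $j\neq i$) if $\nabla_{x_j}L_\delta$ depends on $x_i$. Let $K^i\subset\mathbb{N}$ be the (arbitrary) set of times at which agent $i$ computes. Then $$x^i_i(k+1)=\begin{cases}\Pi_{X_i}[x^i_i(k)-\gamma\nabla_{x_i}L_\delta(x^i(k),\mu(t))],&k\in K^i\\ x^i_i(k),&k\notin K^i,\end{cases}$$ and, for $j\in\mathcal{N}_i$, $x^i_j(k+1)=x^j_j(\tau^i_j(k+1))$ if agent $i$ receives agent $j$'s state at time $k+1$, and $x^i_j(k+1)=x^i_j(k)$ otherwise, where $\tau^i_j(k+1)$ is the time at which agent $j$ computed the value it sends at time $k+1$. An agent sends its current value; messages are sent at arbitrary times and received without delay between sending and receipt. Operation count. $\mathrm{ops}(0,t)=0$.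 Once every primal agent has computed an update to its variable, sent it, and had it received by all other primal agents that need it, say by time $k'$, set $\mathrm{ops}(k',t)=1$. Once after $k'$ every primal agent has computed a new update (with the same $\mu(t)$) and it has been received by all other primal agents that need it, say at time $k''$, set $\mathrm{ops}(k'',t)=2$; and so on. Between these times $\mathrm{ops}(\cdot,t)$ is constant.
   Formalization: The bound is proved for agent i's own entry and those of its essential neighbors; for all n entries only when each other entry x^i_j(k) is a value agent j itself held since the last completed operation, as non-essential entries obey no update law and need not converge. *)

theory Defs
  imports "HOL-Analysis.Analysis"
begin

definition grad :: "(real^'n \<Rightarrow> real) \<Rightarrow> real^'n \<Rightarrow> real^'n" where
  "grad f x = (\<chi> i. frechet_derivative f (at x) (axis i 1))"

text \<open>Entry \<open>(i, j)\<close> is the partial derivative in direction \<open>j\<close> of the \<open>i\<close>-th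
  component of the gradient.\<close>

definition hess :: "(real^'n \<Rightarrow> real) \<Rightarrow> real^'n \<Rightarrow> real^'n^'n" where
  "hess f x = jacobian (grad f) (at x)"

definition twice_cont_diff :: "(real^'n \<Rightarrow> real) \<Rightarrow> bool" where
  "twice_cont_diff f \<longleftrightarrow>
     f differentiable_on UNIV \<and> grad f differentiable_on UNIV \<and> continuous_on UNIV (hess f)"

definition reg_lagrangian ::
  "(real^'n \<Rightarrow> real) \<Rightarrow> (real^'n \<Rightarrow> real^'m) \<Rightarrow> real \<Rightarrow> real^'n \<Rightarrow> real^'m \<Rightarrow> real" where
  "reg_lagrangian h g \<delta> x \<mu> = h x + \<mu> \<bullet> g x - \<delta> / 2 * (norm \<mu>)\<^sup>2"

text \<open>The infimum below is a minimum when \<open>h\<close> is continuous and \<open>X\<close> is compact and non-empty.\<close>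

definition dual_set ::
  "(real^'n \<Rightarrow> real) \<Rightarrow> (real^'n \<Rightarrow> real^'m) \<Rightarrow> (real^'n) set \<Rightarrow> real^'n \<Rightarrow> (real^'m) set" where
  "dual_set h g X xbar =
     {\<mu>. (\<forall>j. 0 \<le> \<mu> $ j) \<and>
         (\<Sum>j\<in>UNIV. \<bar>\<mu> $ j\<bar>) \<le> (h xbar - (INF x\<in>X. h x)) / (MIN j. - (g xbar $ j))}"

definition update_law :: "(real^'n) set \<Rightarrow> real \<Rightarrow> (real^'n \<Rightarrow> real) \<Rightarrow> real^'n \<Rightarrow> real^'n" where
  "update_law X \<gamma> F y = closest_point X (y - \<gamma> *\<^sub>R grad F y)"

text \<open>Agent \<open>j\<close> is an essential neighbor of \<open>i\<close> if the \<open>j\<close>-th partial derivative of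
  the Lagrangian, as a function of \<open>(x, \<mu>)\<close>, depends on the coordinate \<open>x\<^sub>i\<close>.\<close>

definition ess_nbrs :: "(real^'n \<Rightarrow> real^'m \<Rightarrow> real) \<Rightarrow> 'n \<Rightarrow> 'n set" where
  "ess_nbrs L i =
     {j. j \<noteq> i \<and> (\<exists>y z \<mu>. (\<forall>l. l \<noteq> i \<longrightarrow> y $ l = z $ l) \<and>
            grad (\<lambda>x. L x \<mu>) y $ j \<noteq> grad (\<lambda>x. L x \<mu>) z $ j)}"

text \<open>\<open>K j\<close> is the set of times at which agent \<open>j\<close> computes; a computation at time \<open>s\<close> produces
  the value that agent \<open>j\<close> holds from time \<open>s + 1\<close> on.  \<open>stamp K j k\<close> is the time from which
  agent \<open>j\<close> has been holding its most recently computed value at time \<open>k\<close> (\<open>0\<close> if it has not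
  computed yet).  An agent sends its current value and there is no transit delay, so this is the
  time stamp of a message that is sent, and received, at time \<open>k\<close>.\<close>

primrec stamp :: "('n \<Rightarrow> nat set) \<Rightarrow> 'n \<Rightarrow> nat \<Rightarrow> nat" where
  "stamp K j 0 = 0"
| "stamp K j (Suc k) = (if k \<in> K j then Suc k else stamp K j k)"

text \<open>\<open>R i j\<close> is the set of times at which agent \<open>i\<close> receives the state of agent \<open>j\<close>, \<open>N i\<close> is the
  set of essential neighbors of \<open>i\<close>, and \<open>x i k\<close> is the local vector of agent \<open>i\<close> at time \<open>k\<close>.
  An entry \<open>x i k $ j\<close> with \<open>j \<noteq> i\<close>, \<open>j \<notin> N i\<close> obeys no update law.\<close>

definition async_execution ::
  "(real^'n) set \<Rightarrow> ('n \<Rightarrow> real set) \<Rightarrow> real \<Rightarrow> (real^'n \<Rightarrow> real) \<Rightarrow> ('n \<Rightarrow> 'n set) \<Rightarrow>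
   ('n \<Rightarrow> nat set) \<Rightarrow> ('n \<Rightarrow> 'n \<Rightarrow> nat set) \<Rightarrow> ('n \<Rightarrow> nat \<Rightarrow> real^'n) \<Rightarrow> bool" where
  "async_execution X Xs \<gamma> F N K R x \<longleftrightarrow>
     (\<forall>i k. x i k \<in> X) \<and>
     (\<forall>i k. x i (Suc k) $ i =
        (if k \<in> K i then closest_point (Xs i) (x i k $ i - \<gamma> * grad F (x i k) $ i)
         else x i k $ i)) \<and>
     (\<forall>i. \<forall>j\<in>N i. \<forall>k. x i (Suc k) $ j =
        (if Suc k \<in> R i j then x j (stamp K j (Suc k)) $ j else x i k $ j))"

text \<open>Between times \<open>a\<close> and \<open>b\<close> every agent \<open>i\<close> has computed an update, and that very update
  (identified by its time stamp) has been received by every agent \<open>j\<close> that needs it, that is,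
  every \<open>j\<close> with \<open>i \<in> N j\<close>.\<close>

definition op_completed ::
  "('n \<Rightarrow> 'n set) \<Rightarrow> ('n \<Rightarrow> nat set) \<Rightarrow> ('n \<Rightarrow> 'n \<Rightarrow> nat set) \<Rightarrow> nat \<Rightarrow> nat \<Rightarrow> bool" where
  "op_completed N K R a b \<longleftrightarrow>
     (\<forall>i. \<exists>s\<in>K i. a \<le> s \<and> Suc s \<le> b \<and>
        (\<forall>j. i \<in> N j \<longrightarrow> (\<exists>r\<in>R j i. r \<le> b \<and> stamp K i r = Suc s)))"

text \<open>The number of operations completed by time \<open>k\<close>, and the time at which the latest one was
  completed (\<open>0\<close> if there is none).\<close>

primrec op_state ::
  "('n \<Rightarrow> 'n set) \<Rightarrow> ('n \<Rightarrow> nat set) \<Rightarrow> ('n \<Rightarrow> 'n \<Rightarrow> nat set) \<Rightarrow> nat \<Rightarrow> nat \<times> nat" where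
  "op_state N K R 0 = (0, 0)"
| "op_state N K R (Suc k) =
     (let (c, a) = op_state N K R k
      in if op_completed N K R a (Suc k) then (Suc c, Suc k) else (c, a))"

definition ops ::
  "('n \<Rightarrow> 'n set) \<Rightarrow> ('n \<Rightarrow> nat set) \<Rightarrow> ('n \<Rightarrow> 'n \<Rightarrow> nat set) \<Rightarrow> nat \<Rightarrow> nat" where
  "ops N K R k = fst (op_state N K R k)"

text \<open>The entry for \<open>j\<close> in agent \<open>i\<close>'s vector at time \<open>k\<close> is a value that agent \<open>j\<close> itself has
  held since the latest completed operation.  No law governs the entries with \<open>j \<noteq> i\<close>,
  \<open>j \<notin> N i\<close>, which no computation of agent \<open>i\<close> uses: if such an entry is simply left at its
  initial value, it does not converge.  A bound on all entries of \<open>x i k\<close> is therefore only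
  possible if those entries are up to date in this sense.\<close>

definition up_to_date ::
  "('n \<Rightarrow> 'n set) \<Rightarrow> ('n \<Rightarrow> nat set) \<Rightarrow> ('n \<Rightarrow> 'n \<Rightarrow> nat set) \<Rightarrow> ('n \<Rightarrow> nat \<Rightarrow> real^'n) \<Rightarrow>
   'n \<Rightarrow> nat \<Rightarrow> 'n \<Rightarrow> bool" where
  "up_to_date N K R x i k j \<longleftrightarrow>
     (\<exists>s\<le>k. ops N K R s = ops N K R k \<and> x i k $ j = x j s $ j)"

end

theory Submission
  imports Defs
begin

text \<open>Diagonal dominance makes each single-coordinate update a contraction with factor \<open>q\<^sub>p\<close> in
  the maximum norm.  An error bound \<open>B\<close> on all entries that agents use is therefore preserved
  by every computation and message, and once each agent has computed and delivered an update,
  all these entries stem from computations on data within \<open>B\<close> and so have error at most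
  \<open>q\<^sub>p B\<close>.  Each operation thus gains one factor \<open>q\<^sub>p\<close>.\<close>

subsection \<open>Gradients and Hessians\<close>

lemma has_derivative_grad:
  fixes f :: "real^'n \<Rightarrow> real"
  assumes "f differentiable at y"
  shows "(f has_derivative (\<lambda>v. grad f y \<bullet> v)) (at y)"
proof -
  let ?D = "frechet_derivative f (at y)"
  have D: "(f has_derivative ?D) (at y)"
    using assms by (simp add: frechet_derivative_works)
  then have lin: "linear ?D"
    by (rule has_derivative_linear)
  have "?D v = grad f y \<bullet> v" for v
  proof -
    have "?D v = ?D (\<Sum>i\<in>UNIV. v $ i *\<^sub>R axis i 1)"
      by (simp add: basis_expansion flip: scalar_mult_eq_scaleR)
    also have "\<dots> = (\<Sum>i\<in>UNIV. v $ i * ?D (axis i 1))"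
      by (simp add: linear_sum[OF lin] linear_cmul[OF lin])
    finally show ?thesis
      by (simp add: grad_def inner_vec_def mult.commute)
  qed
  then show ?thesis
    using D by presburger
qed

lemma grad_eqI:
  fixes f :: "real^'n \<Rightarrow> real"
  assumes "(f has_derivative (\<lambda>v. d \<bullet> v)) (at y)"
  shows "grad f y = d"
  by (simp add: grad_def vec_eq_iff inner_axis flip: frechet_derivative_at[OF assms])

lemma has_derivative_hess:
  fixes f :: "real^'n \<Rightarrow> real"
  assumes "grad f differentiable at y"
  shows "(grad f has_derivative (\<lambda>v. hess f y *v v)) (at y)"
  using assms by (simp add: hess_def flip: jacobian_works)

lemma hess_eqI:
  fixes f :: "real^'n \<Rightarrow> real"
  assumes "(grad f has_derivative (\<lambda>v. A *v v)) (at y)"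
  shows "hess f y = A"
  by (simp add: hess_def jacobian_def flip: frechet_derivative_at[OF assms])

text \<open>Restriction to lines gives access to one-variable calculus: tangent inequalities,
  constancy under a zero derivative, uniqueness of derivatives.\<close>

lemma DERIV_along_line:
  fixes f :: "real^'n \<Rightarrow> real"
  assumes "\<And>y. f differentiable at y"
  shows "((\<lambda>t. f (y + t *\<^sub>R v)) has_real_derivative grad f (y + t *\<^sub>R v) \<bullet> v) (at t within S)"
proof -
  have "((\<lambda>t. f (y + t *\<^sub>R v)) has_derivative (\<lambda>s. grad f (y + t *\<^sub>R v) \<bullet> (s *\<^sub>R v))) (at t within S)"
    by (rule has_derivative_compose[OF _ has_derivative_grad[OF assms]])
      (auto intro!: derivative_eq_intros)
  then show ?thesis
    by (rule has_derivative_imp_has_field_derivative) simp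
qed

lemma DERIV_grad_along_line:
  fixes f :: "real^'n \<Rightarrow> real"
  assumes "\<And>y. grad f differentiable at y"
  shows "((\<lambda>t. grad f (y + t *\<^sub>R v) $ i) has_real_derivative
           (hess f (y + t *\<^sub>R v) *v v) $ i) (at t within S)"
proof -
  have "((\<lambda>t. grad f (y + t *\<^sub>R v)) has_derivative (\<lambda>s. hess f (y + t *\<^sub>R v) *v (s *\<^sub>R v)))
          (at t within S)"
    by (rule has_derivative_compose[OF _ has_derivative_hess[OF assms]])
      (auto intro!: derivative_eq_intros)
  then have "((\<lambda>t. grad f (y + t *\<^sub>R v) $ i) has_derivative
      (\<lambda>s. (hess f (y + t *\<^sub>R v) *v (s *\<^sub>R v)) $ i)) (at t within S)"
    by (rule bounded_linear.has_derivative[OF bounded_linear_vec_nth])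
  then show ?thesis
    by (rule has_derivative_imp_has_field_derivative) (simp add: matrix_vector_mult_scaleR)
qed

lemma matrix_vector_mult_axis: "(A *v axis j 1) $ i = (A $ i $ j :: real)"
  by (simp add: matrix_vector_mul_component inner_axis)

text \<open>A convex function has a nondecreasing derivative along each coordinate line, and the
  slope of that derivative is the diagonal Hessian entry. This removes the absolute value around the
  diagonal entry in the dominance condition.\<close>

lemma hess_diag_nonneg:
  fixes f :: "real^'n \<Rightarrow> real"
  assumes f: "\<And>y. f differentiable at y" and grad: "\<And>y. grad f differentiable at y"
    and conv: "convex_on UNIV f"
  shows "0 \<le> hess f y $ i $ i"
proof -
  define p where "p t = f (y + t *\<^sub>R axis i 1)" for t
  define p' where "p' t = grad f (y + t *\<^sub>R axis i 1) $ i" for t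
  have p': "(p has_real_derivative p' t) (at t)" for t
    using DERIV_along_line[OF f, of y "axis i 1" t UNIV] by (simp add: p_def[abs_def] p'_def inner_axis)
  have "convex_on UNIV p"
  proof (rule convex_onI)
    fix t a b :: real
    assume t: "0 < t" "t < 1"
    have "y + ((1 - t) *\<^sub>R a + t *\<^sub>R b) *\<^sub>R axis i 1
        = (1 - t) *\<^sub>R (y + a *\<^sub>R axis i 1) + t *\<^sub>R (y + b *\<^sub>R axis i 1)"
      by (simp add: algebra_simps)
    then show "p ((1 - t) *\<^sub>R a + t *\<^sub>R b) \<le> (1 - t) * p a + t * p b"
      unfolding p_def using convex_onD[OF conv, of t] t by simp
  qed simp
  then have tangent: "p b - p a \<ge> p' a * (b - a)" for a b
    by (rule convex_on_imp_above_tangent[where A = UNIV]) (auto simp: p')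
  have "mono_on UNIV p'"
  proof (rule mono_onI)
    fix a b :: real
    assume "a \<le> b"
    \<comment> \<open>Adding the tangent inequalities at \<open>a\<close> and at \<open>b\<close>
      cancels the values of \<open>p\<close>.\<close>
    have "(p' b - p' a) * (b - a) \<ge> 0"
      using tangent[of a b] tangent[of b a] by (simp add: algebra_simps)
    then show "p' a \<le> p' b"
      using \<open>a \<le> b\<close> by (cases "a = b") (auto simp: zero_le_mult_iff)
  qed
  moreover have "(p' has_real_derivative hess f y $ i $ i) (at 0)"
    using DERIV_grad_along_line[OF grad, of y "axis i 1" i 0 UNIV]
    by (simp add: p'_def[abs_def] matrix_vector_mult_axis)
  ultimately show ?thesis
    by (rule mono_on_imp_deriv_nonneg) simp
qed

text \<open>The neighbor relation is defined through \<open>\<partial>\<^sub>j f\<close>, but the update of agent \<open>i\<close> uses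
  \<open>\<partial>\<^sub>i f\<close>.  If \<open>\<partial>\<^sub>j f\<close> does not depend on \<open>y\<^sub>i\<close>, the increments of \<open>f\<close> in direction \<open>i\<close> do not
  depend on \<open>y\<^sub>j\<close>; so symmetry of second derivatives is not needed to pass from one to the other.\<close>

lemma hess_eq_0_if_partial_indep:
  fixes f :: "real^'n \<Rightarrow> real"
  assumes f: "\<And>y. f differentiable at y" and grad: "\<And>y. grad f differentiable at y"
    and indep: "\<And>y z. (\<forall>l. l \<noteq> i \<longrightarrow> y $ l = z $ l) \<Longrightarrow> grad f y $ j = grad f z $ j"
  shows "hess f y $ i $ j = 0"
proof -
  have incr: "f (w + s *\<^sub>R axis j 1 + t *\<^sub>R axis i 1) - f (w + s *\<^sub>R axis j 1)
      = f (w + t *\<^sub>R axis i 1) - f w" for w s t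
  proof -
    \<comment> \<open>\<open>r\<close> follows the increment in direction \<open>i\<close> while the
      base point moves in direction \<open>j\<close>. Its derivative is a difference of
      \<open>j\<close>-th partials at two points that differ at most in coordinate
      \<open>i\<close>.\<close>
    define r where "r s = f ((w + t *\<^sub>R axis i 1) + s *\<^sub>R axis j 1) - f (w + s *\<^sub>R axis j 1)" for s
    have "(r has_real_derivative 0) (at s)" for s
    proof -
      have "grad f ((w + t *\<^sub>R axis i 1) + s *\<^sub>R axis j 1) $ j = grad f (w + s *\<^sub>R axis j 1) $ j"
        by (rule indep) (simp add: axis_def)
      then show ?thesis
        unfolding r_def
        using DERIV_diff[OF DERIV_along_line[OF f, of "w + t *\<^sub>R axis i 1" "axis j 1" s UNIV]
            DERIV_along_line[OF f, of w "axis j 1" s UNIV]]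
        by (simp add: inner_axis)
    qed
    then have "r s = r 0"
      by (intro DERIV_isconst_all) auto
    then show ?thesis
      by (simp add: r_def add_ac)
  qed
  \<comment> \<open>Differentiating both sides of \<open>incr\<close> at \<open>t = 0\<close> turns
    equal increments into equal \<open>i\<close>-th partials.\<close>
  have "grad f (w + s *\<^sub>R axis j 1) $ i = grad f w $ i" for w s
  proof -
    let ?w = "w + s *\<^sub>R axis j 1"
    have "((\<lambda>t. f (?w + t *\<^sub>R axis i 1) - f ?w) has_real_derivative grad f ?w $ i) (at 0)"
      using DERIV_diff[OF DERIV_along_line[OF f, of ?w "axis i 1" 0 UNIV] DERIV_const[of "f ?w"]]
      by (simp add: inner_axis)
    moreover have "((\<lambda>t. f (w + t *\<^sub>R axis i 1) - f w) has_real_derivative grad f w $ i) (at 0)"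
      using DERIV_diff[OF DERIV_along_line[OF f, of w "axis i 1" 0 UNIV] DERIV_const[of "f w"]]
      by (simp add: inner_axis)
    ultimately show ?thesis
      unfolding incr by (rule DERIV_unique)
  qed
  then have "((\<lambda>t. grad f (y + t *\<^sub>R axis j 1) $ i) has_real_derivative 0) (at 0)"
    by simp
  with DERIV_grad_along_line[OF grad, of y "axis j 1" i 0 UNIV]
  show ?thesis
    by (auto simp: matrix_vector_mult_axis dest: DERIV_unique)
qed

subsection \<open>The regularized Lagrangian\<close>

lemma twice_cont_diffD:
  assumes "twice_cont_diff f"
  shows "f differentiable at y" "grad f differentiable at y" "continuous_on S (hess f)"
  using assms unfolding twice_cont_diff_def
  by (auto simp: differentiable_on_def intro: continuous_on_subset)

context
  fixes h :: "real^'n \<Rightarrow> real" and g :: "real^'n \<Rightarrow> real^'m"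
  assumes h: "twice_cont_diff h" and g: "\<forall>j. twice_cont_diff (\<lambda>y. g y $ j)"
begin

lemma has_derivative_reg_lagrangian:
  "((\<lambda>z. reg_lagrangian h g \<delta> z \<mu>) has_derivative
     (\<lambda>v. (grad h y + (\<Sum>j\<in>UNIV. \<mu> $ j *\<^sub>R grad (\<lambda>y. g y $ j) y)) \<bullet> v)) (at y)"
proof -
  have "((\<lambda>z. h z + (\<Sum>j\<in>UNIV. \<mu> $ j * g z $ j) - \<delta> / 2 * (norm \<mu>)\<^sup>2) has_derivative
     (\<lambda>v. grad h y \<bullet> v + (\<Sum>j\<in>UNIV. \<mu> $ j * (grad (\<lambda>y. g y $ j) y \<bullet> v)) - 0)) (at y)"
    using h g
    by (intro has_derivative_diff has_derivative_add has_derivative_sum has_derivative_const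
        has_derivative_mult_right has_derivative_grad twice_cont_diffD) auto
  then show ?thesis
    by (simp add: reg_lagrangian_def inner_vec_def[of \<mu>] inner_add_left inner_sum_left)
qed

lemma differentiable_reg_lagrangian: "(\<lambda>z. reg_lagrangian h g \<delta> z \<mu>) differentiable at y"
  using has_derivative_reg_lagrangian by (rule differentiableI)

lemma grad_reg_lagrangian:
  "grad (\<lambda>z. reg_lagrangian h g \<delta> z \<mu>)
     = (\<lambda>y. grad h y + (\<Sum>j\<in>UNIV. \<mu> $ j *\<^sub>R grad (\<lambda>y. g y $ j) y))"
  by (intro ext grad_eqI has_derivative_reg_lagrangian)

lemma has_derivative_grad_reg_lagrangian:
  "(grad (\<lambda>z. reg_lagrangian h g \<delta> z \<mu>) has_derivative
     (\<lambda>v. (hess h y + (\<Sum>j\<in>UNIV. \<mu> $ j *\<^sub>R hess (\<lambda>y. g y $ j) y)) *v v)) (at y)"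
proof -
  have "((\<lambda>y. grad h y + (\<Sum>j\<in>UNIV. \<mu> $ j *\<^sub>R grad (\<lambda>y. g y $ j) y)) has_derivative
     (\<lambda>v. hess h y *v v + (\<Sum>j\<in>UNIV. \<mu> $ j *\<^sub>R (hess (\<lambda>y. g y $ j) y *v v)))) (at y)"
    using h g
    by (intro has_derivative_add has_derivative_sum has_derivative_scaleR_right
        has_derivative_hess twice_cont_diffD) auto
  moreover have "(\<Sum>j\<in>A. \<mu> $ j *\<^sub>R hess (\<lambda>y. g y $ j) y) *v v
      = (\<Sum>j\<in>A. \<mu> $ j *\<^sub>R (hess (\<lambda>y. g y $ j) y *v v))" for A v
    by (induction A rule: infinite_finite_induct)
      (auto simp: matrix_vector_mult_add_rdistrib scaleR_matrix_vector_assoc)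
  ultimately show ?thesis
    by (simp add: grad_reg_lagrangian matrix_vector_mult_add_rdistrib)
qed

lemma grad_differentiable_reg_lagrangian:
  "grad (\<lambda>z. reg_lagrangian h g \<delta> z \<mu>) differentiable at y"
  using has_derivative_grad_reg_lagrangian by (rule differentiableI)

lemma hess_reg_lagrangian:
  "hess (\<lambda>z. reg_lagrangian h g \<delta> z \<mu>) y
     = hess h y + (\<Sum>j\<in>UNIV. \<mu> $ j *\<^sub>R hess (\<lambda>y. g y $ j) y)"
  by (intro hess_eqI has_derivative_grad_reg_lagrangian)

text \<open>The Hessians of \<open>h\<close> and of the constraints are continuous on a compact set,
  and the multipliers are bounded in the 1-norm. The bound makes the suprema in the step-size
  condition true upper bounds.\<close>

lemma hess_reg_lagrangian_bounded:
  assumes X: "compact X"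
  shows "\<exists>B. \<forall>i. \<forall>y\<in>X. \<forall>\<mu>. (\<Sum>j\<in>UNIV. \<bar>\<mu> $ j\<bar>) \<le> C \<longrightarrow>
    (\<Sum>j\<in>UNIV. \<bar>hess (\<lambda>z. reg_lagrangian h g \<delta> z \<mu>) y $ i $ j\<bar>) \<le> B"
proof -
  have bdd: "\<exists>b. \<forall>y\<in>X. norm (hess f y) \<le> b" if "twice_cont_diff f" for f :: "real^'n \<Rightarrow> real"
    using compact_imp_bounded[OF compact_continuous_image[OF twice_cont_diffD(3)[OF that] X]]
    by (auto simp: bounded_iff)
  obtain b0 where b0: "\<And>y. y \<in> X \<Longrightarrow> norm (hess h y) \<le> b0"
    using bdd[OF h] by blast
  have "\<forall>j. \<exists>b. \<forall>y\<in>X. norm (hess (\<lambda>y. g y $ j) y) \<le> b"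
    using bdd g by blast
  from choice[OF this] obtain b
    where b: "norm (hess (\<lambda>y. g y $ j) y) \<le> b j" if "y \<in> X" for j y
    by blast
  define B where "B = b0 + (\<Sum>l\<in>UNIV. C * b l)"
  have "(\<Sum>j\<in>UNIV. \<bar>hess (\<lambda>z. reg_lagrangian h g \<delta> z \<mu>) y $ i $ j\<bar>) \<le> real CARD('n) * B"
    if y: "y \<in> X" and \<mu>: "(\<Sum>j\<in>UNIV. \<bar>\<mu> $ j\<bar>) \<le> C" for i y \<mu>
  proof -
    let ?A = "hess (\<lambda>z. reg_lagrangian h g \<delta> z \<mu>) y"
    \<comment> \<open>This also yields \<open>0 \<le> C\<close>, which the product estimate below
      requires.\<close>
    have \<mu>_le: "\<bar>\<mu> $ l\<bar> \<le> C" for l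
      using member_le_sum[of l UNIV "\<lambda>l. \<bar>\<mu> $ l\<bar>"] \<mu> by simp
    have "norm ?A \<le> norm (hess h y) + (\<Sum>l\<in>UNIV. norm (\<mu> $ l *\<^sub>R hess (\<lambda>y. g y $ l) y))"
      unfolding hess_reg_lagrangian
      by (rule order_trans[OF norm_triangle_ineq]) (simp add: norm_sum del: norm_scaleR)
    also have "\<dots> \<le> B"
      unfolding B_def norm_scaleR
      by (intro add_mono sum_mono mult_mono \<mu>_le b b0 y) (auto intro: order_trans[OF _ \<mu>_le])
    finally have "\<bar>?A $ i $ j\<bar> \<le> B" for j
      by (metis Finite_Cartesian_Product.norm_nth_le order_trans real_norm_def)
    then show ?thesis
      using sum_bounded_above[of UNIV "\<lambda>j. \<bar>?A $ i $ j\<bar>" B] by simp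
  qed
  then show ?thesis by blast
qed

lemma convex_reg_lagrangian:
  assumes "convex_on UNIV h" "\<forall>j. convex_on UNIV (\<lambda>y. g y $ j)" "\<forall>j. 0 \<le> \<mu> $ j"
  shows "convex_on UNIV (\<lambda>z. reg_lagrangian h g \<delta> z \<mu>)"
proof -
  have "convex_on UNIV (\<lambda>z. \<Sum>j\<in>A. \<mu> $ j * g z $ j)" for A
    by (induction A rule: infinite_finite_induct)
      (use assms in \<open>auto intro!: convex_on_add convex_on_cmul simp: convex_on_const\<close>)
  then have "convex_on UNIV (\<lambda>z. (h z + (\<Sum>j\<in>UNIV. \<mu> $ j * g z $ j)) + - (\<delta> / 2 * (norm \<mu>)\<^sup>2))"
    using assms by (intro convex_on_add) (auto simp: convex_on_const)
  then show ?thesis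
    by (simp add: reg_lagrangian_def inner_vec_def[of \<mu>])
qed

end

text \<open>A real supremum is known to dominate its set only when the set is bounded above; the
  uniform \<open>B\<close> ensures this for the inner and the outer supremum.\<close>

lemma row_sum_le_MAX_SUP:
  fixes s :: "'n::finite \<Rightarrow> 'a \<Rightarrow> 'b \<Rightarrow> real"
  assumes bound: "\<And>i y \<mu>. y \<in> X \<Longrightarrow> \<mu> \<in> M \<Longrightarrow> s i y \<mu> \<le> B" and "y \<in> X" "\<mu> \<in> M"
  shows "s i y \<mu> \<le> (MAX i. SUP y\<in>X. SUP \<mu>\<in>M. s i y \<mu>)"
proof -
  have "s i y \<mu> \<le> (SUP \<mu>\<in>M. s i y \<mu>)"
    using assms by (intro cSUP_upper bdd_aboveI2[of _ _ B]) auto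
  also have "\<dots> \<le> (SUP y\<in>X. SUP \<mu>\<in>M. s i y \<mu>)"
    using assms by (intro cSUP_upper bdd_aboveI2[of _ _ B] cSUP_least) auto
  also have "\<dots> \<le> (MAX i. SUP y\<in>X. SUP \<mu>\<in>M. s i y \<mu>)"
    by (rule Max_ge) auto
  finally show ?thesis .
qed

subsection \<open>Projected gradient steps\<close>

text \<open>Choosing the nearest value in each coordinate minimizes every component of the
  difference, hence its Euclidean norm, and the minimizer is unique by convexity. Thus the scalar
  projections of the agents are the components of the projection onto \<open>X\<close>.\<close>

lemma closest_point_box:
  fixes X :: "(real^'n) set"
  assumes X: "X = {y. \<forall>i. y $ i \<in> Xs i}" "convex X" "closed X" "X \<noteq> {}"
    and Xs: "\<And>i. closed (Xs i)"
  shows "closest_point X y $ i = closest_point (Xs i) (y $ i)"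
proof -
  define w where "w = (\<chi> i. closest_point (Xs i) (y $ i))"
  have ne: "Xs i \<noteq> {}" for i
    using X(1,4) by auto
  have "w \<in> X"
    unfolding X(1) using closest_point_in_set[OF Xs ne] by (simp add: w_def)
  moreover have "dist y w \<le> dist y z" if "z \<in> X" for z
    unfolding dist_norm
  proof (rule norm_le_componentwise_cart)
    fix i
    have "dist (y $ i) (closest_point (Xs i) (y $ i)) \<le> dist (y $ i) (z $ i)"
      by (rule closest_point_le[OF Xs]) (use that in \<open>simp add: X(1)\<close>)
    then show "norm ((y - w) $ i) \<le> norm ((y - z) $ i)"
      by (simp add: w_def dist_norm)
  qed
  ultimately have "w = closest_point X y"
    using X by (intro closest_point_unique) auto
  then show ?thesis
    by (metis w_def vec_lambda_beta)
qed

text \<open>A gradient step contracts in the maximum norm: its Jacobian has the rows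
  \<open>e\<^sub>i - \<gamma> H\<^sub>i\<close>, whose absolute row sums are \<open>1 - \<gamma> H\<^sub>i\<^sub>i + \<gamma> (\<Sum>j\<noteq>i. \<bar>H\<^sub>i\<^sub>j\<bar>) \<le> 1 - \<gamma> \<beta>\<close>.\<close>

lemma gradient_step_contraction:
  fixes F :: "real^'n \<Rightarrow> real"
  assumes grad: "\<And>y. grad F differentiable at y"
    and X: "convex X" "y \<in> X" "z \<in> X" and \<gamma>: "0 \<le> \<gamma>"
    and row: "\<And>w. w \<in> X \<Longrightarrow> \<gamma> * hess F w $ i $ i \<le> 1"
    and dom: "\<And>w. w \<in> X \<Longrightarrow> (\<Sum>j\<in>UNIV - {i}. \<bar>hess F w $ i $ j\<bar>) \<le> hess F w $ i $ i - \<beta>"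
    and B: "\<And>j. j \<in> S \<Longrightarrow> \<bar>y $ j - z $ j\<bar> \<le> B" and i: "i \<in> S"
    and zero: "\<And>j w. j \<notin> S \<Longrightarrow> hess F w $ i $ j = 0"
  shows "\<bar>(y $ i - \<gamma> * grad F y $ i) - (z $ i - \<gamma> * grad F z $ i)\<bar> \<le> (1 - \<gamma> * \<beta>) * B"
proof -
  define d where "d = y - z"
  \<comment> \<open>Coordinate \<open>i\<close> of the gradient step along the segment from
    \<open>z\<close> to \<open>y\<close>. The mean value theorem reduces its total change to one
    Hessian row at an intermediate point.\<close>
  define p where "p t = (z + t *\<^sub>R d) $ i - \<gamma> * grad F (z + t *\<^sub>R d) $ i" for t
  define p' where "p' t = d $ i - \<gamma> * (hess F (z + t *\<^sub>R d) *v d) $ i" for t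
  have "(p has_real_derivative p' t) (at t)" for t
    unfolding p_def p'_def vector_add_component vector_scaleR_component
    by (auto intro!: derivative_eq_intros DERIV_grad_along_line[OF grad])
  then obtain t where t: "0 < t" "t < 1" "p 1 - p 0 = p' t"
    using MVT2[of 0 1 p p'] by auto
  define A where "A = hess F (z + t *\<^sub>R d)"
  have "z + t *\<^sub>R d = (1 - t) *\<^sub>R z + t *\<^sub>R y"
    by (simp add: d_def algebra_simps)
  then have w: "z + t *\<^sub>R d \<in> X"
    using X t by (auto intro: convexD)
  have "B \<ge> 0"
    using B[OF i] by linarith
  \<comment> \<open>Outside \<open>S\<close> the difference \<open>d\<close> has no known bound, but
    there the Hessian entry vanishes.\<close>
  have term_le: "\<bar>A $ i $ j\<bar> * \<bar>d $ j\<bar> \<le> \<bar>A $ i $ j\<bar> * B" for j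
    using B zero by (cases "j \<in> S") (auto simp: A_def d_def mult_left_mono)
  have "p' t = (1 - \<gamma> * A $ i $ i) * d $ i - \<gamma> * (\<Sum>j\<in>UNIV - {i}. A $ i $ j * d $ j)"
    by (simp add: p'_def A_def[symmetric] matrix_vector_mult_def sum.remove[of UNIV i] algebra_simps)
  also have "\<bar>\<dots>\<bar> \<le> (1 - \<gamma> * A $ i $ i) * B + \<gamma> * (\<Sum>j\<in>UNIV - {i}. \<bar>A $ i $ j\<bar> * B)"
  proof -
    \<comment> \<open>By \<open>row\<close> the factor is nonnegative, so it equals its own absolute
      value.\<close>
    have "\<bar>(1 - \<gamma> * A $ i $ i) * d $ i\<bar> \<le> (1 - \<gamma> * A $ i $ i) * B"
      using B[OF i] row[OF w] by (simp add: abs_mult A_def d_def mult_left_mono)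
    moreover have "\<bar>\<Sum>j\<in>UNIV - {i}. A $ i $ j * d $ j\<bar> \<le> (\<Sum>j\<in>UNIV - {i}. \<bar>A $ i $ j\<bar> * B)"
      by (rule order_trans[OF sum_abs]) (simp add: abs_mult sum_mono term_le)
    then have "\<bar>\<gamma> * (\<Sum>j\<in>UNIV - {i}. A $ i $ j * d $ j)\<bar> \<le> \<gamma> * (\<Sum>j\<in>UNIV - {i}. \<bar>A $ i $ j\<bar> * B)"
      using \<gamma> by (simp add: abs_mult mult_left_mono)
    ultimately show ?thesis
      by linarith
  qed
  also have "\<dots> = ((1 - \<gamma> * A $ i $ i) + \<gamma> * (\<Sum>j\<in>UNIV - {i}. \<bar>A $ i $ j\<bar>)) * B"
    by (simp add: distrib_right mult.assoc flip: sum_distrib_right)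
  also have "\<dots> \<le> (1 - \<gamma> * \<beta>) * B"
  proof (rule mult_right_mono[OF _ \<open>B \<ge> 0\<close>])
    have "\<gamma> * (\<Sum>j\<in>UNIV - {i}. \<bar>A $ i $ j\<bar>) \<le> \<gamma> * (A $ i $ i - \<beta>)"
      using dom[OF w] \<gamma> by (simp add: A_def mult_left_mono)
    then show "(1 - \<gamma> * A $ i $ i) + \<gamma> * (\<Sum>j\<in>UNIV - {i}. \<bar>A $ i $ j\<bar>) \<le> 1 - \<gamma> * \<beta>"
      by (simp add: algebra_simps)
  qed
  finally show ?thesis
    using t(3) by (simp add: p_def d_def)
qed

subsection \<open>Asynchronous executions\<close>

lemma stamp_le: "stamp K i k \<le> k"
  by (induction k) auto

text \<open>Messages carry no stale data.\<close>

lemma own_state_stamp: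
  assumes "async_execution X Xs \<gamma> F N K R x"
  shows "x i (stamp K i k) $ i = x i k $ i"
  using assms by (induction k) (auto simp: async_execution_def)

text \<open>A sender's own entry is unchanged since its stamp, so a received value may be read as
  the sender's current one.\<close>

lemma neighbor_state_Suc:
  assumes exec: "async_execution X Xs \<gamma> F N K R x" and "j \<in> N i"
  shows "x i (Suc k) $ j = (if Suc k \<in> R i j then x j (Suc k) $ j else x i k $ j)"
proof -
  have "x i (Suc k) $ j = (if Suc k \<in> R i j then x j (stamp K j (Suc k)) $ j else x i k $ j)"
    using assms unfolding async_execution_def by blast
  then show ?thesis
    unfolding own_state_stamp[OF exec] .
qed

text \<open>The bound covers exactly the entries governed by an update law; these are also the ones
  on which the computations depend.\<close>

definition used_within ::
  "('n \<Rightarrow> 'n set) \<Rightarrow> ('n \<Rightarrow> nat \<Rightarrow> real^'n) \<Rightarrow> real^'n \<Rightarrow> real \<Rightarrow> nat \<Rightarrow> bool" where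
  "used_within N x z B k \<longleftrightarrow> (\<forall>i. \<forall>j\<in>insert i (N i). \<bar>x i k $ j - z $ j\<bar> \<le> B)"

section \<open>Error propagation for computations that contract towards a point
  \<open>z\<close>\<close>

context
  fixes X :: "(real^'n) set" and Xs \<gamma> F N K R and x :: "'n \<Rightarrow> nat \<Rightarrow> real^'n"
    and z :: "real^'n" and q :: real
  assumes exec: "async_execution X Xs \<gamma> F N K R x"
    and q: "0 \<le> q" "q \<le> 1"
    and contr: "\<And>i k B. (\<And>j. j \<in> insert i (N i) \<Longrightarrow> \<bar>x i k $ j - z $ j\<bar> \<le> B) \<Longrightarrow>
      \<bar>closest_point (Xs i) (x i k $ i - \<gamma> * grad F (x i k) $ i) - z $ i\<bar> \<le> q * B"
begin

lemma own_state_Suc: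
  "x i (Suc k) $ i =
     (if k \<in> K i then closest_point (Xs i) (x i k $ i - \<gamma> * grad F (x i k) $ i) else x i k $ i)"
  using exec unfolding async_execution_def by blast

lemma computed_state_bound:
  assumes "used_within N x z B k" "k \<in> K i"
  shows "\<bar>x i (Suc k) $ i - z $ i\<bar> \<le> q * B"
proof -
  have "\<bar>x i k $ j - z $ j\<bar> \<le> B" if "j \<in> insert i (N i)" for j
    using assms(1) that unfolding used_within_def by blast
  from contr[OF this] show ?thesis
    using assms(2) by (simp add: own_state_Suc)
qed

text \<open>A computation yields error at most \<open>q * B \<le> B\<close>, and a message copies
  the sender's own entry of the same time. Hence own entries are treated first and received ones
  follow.\<close>

lemma used_within_mono:
  assumes "used_within N x z B k" "k \<le> k'" "0 \<le> B"
  shows "used_within N x z B k'"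
  using assms(2)
proof (induction k' rule: dec_induct)
  case base
  then show ?case using assms by simp
next
  case (step m)
  have qB: "q * B \<le> B"
    using q \<open>0 \<le> B\<close> by (simp add: mult_left_le_one_le)
  have own: "\<bar>x i (Suc m) $ i - z $ i\<bar> \<le> B" for i
  proof (cases "m \<in> K i")
    case True
    then show ?thesis
      using computed_state_bound[OF step.IH] qB by (meson order_trans)
  next
    case False
    then show ?thesis
      using step.IH by (simp add: own_state_Suc used_within_def)
  qed
  moreover have "\<bar>x i (Suc m) $ j - z $ j\<bar> \<le> B" if "j \<in> N i" for i j
    using own[of j] step.IH that by (simp add: neighbor_state_Suc[of X Xs, OF exec] used_within_def)
  ultimately show ?case
    by (simp add: used_within_def)
qed

text \<open>After its computation at time \<open>s\<close>, an agent's own entry is either kept or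
  recomputed from data within \<open>B\<close>, so it stays within \<open>q * B\<close>. A copy
  received at \<open>r \<ge> Suc s\<close> inherits this bound, and so does every later
  copy.\<close>

lemma used_within_op_completed:
  assumes W: "used_within N x z B a" and "0 \<le> B" and "op_completed N K R a b"
  shows "used_within N x z (q * B) b"
proof -
  have W': "used_within N x z B m" if "a \<le> m" for m
    using used_within_mono[OF W that \<open>0 \<le> B\<close>] .
  have "\<bar>x i b $ i - z $ i\<bar> \<le> q * B \<and> (\<forall>j. i \<in> N j \<longrightarrow> \<bar>x j b $ i - z $ i\<bar> \<le> q * B)" for i
  proof -
    obtain s where s: "s \<in> K i" "a \<le> s" "Suc s \<le> b"
      "\<And>j. i \<in> N j \<Longrightarrow> \<exists>r\<in>R j i. r \<le> b \<and> stamp K i r = Suc s"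
      using assms(3) unfolding op_completed_def by blast
    have own: "\<bar>x i m $ i - z $ i\<bar> \<le> q * B" if "Suc s \<le> m" for m
      using that
    proof (induction m rule: dec_induct)
      case base
      show ?case using computed_state_bound[OF W'] s by simp
    next
      case (step m)
      then show ?case
        using computed_state_bound[OF W', of m i] s(2) by (cases "m \<in> K i") (auto simp: own_state_Suc)
    qed
    have "\<bar>x j b $ i - z $ i\<bar> \<le> q * B" if j: "i \<in> N j" for j
    proof -
      obtain r where r: "r \<in> R j i" "r \<le> b" "stamp K i r = Suc s"
        using s(4)[OF j] by blast
      then have "Suc s \<le> r"
        using stamp_le[of K i r] by simp
      show ?thesis
        using r(2)
      proof (induction b rule: dec_induct)
        case base
        \<comment> \<open>The reception law speaks of successor times; \<open>r\<close> is one
          because \<open>Suc s \<le> r\<close>.\<close>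
        have "x j r $ i = x i r $ i"
          using neighbor_state_Suc[of X Xs, OF exec j] r(1) \<open>Suc s \<le> r\<close> by (cases r) auto
        then show ?case using own \<open>Suc s \<le> r\<close> by simp
      next
        case (step m)
        then show ?case
          using own[of "Suc m"] \<open>Suc s \<le> r\<close> by (simp add: neighbor_state_Suc[of X Xs, OF exec j])
      qed
    qed
    then show ?thesis
      using own s(3) by blast
  qed
  then show ?thesis
    by (auto simp: used_within_def)
qed

lemma used_within_ops:
  assumes init: "used_within N x z D 0" and "0 \<le> D"
  shows "used_within N x z (q ^ ops N K R k * D) k"
proof -
  \<comment> \<open>The induction asserts the bound at the completion time of the latest operation,
    since the next operation is counted from there. Monotonicity then carries it to
    \<open>k\<close>.\<close>
  have "snd (op_state N K R k) \<le> k \<and>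
      used_within N x z (q ^ fst (op_state N K R k) * D) (snd (op_state N K R k))"
  proof (induction k)
    case 0
    then show ?case using init by simp
  next
    case (Suc k)
    obtain c a where ca: "op_state N K R k = (c, a)"
      by fastforce
    show ?case
    proof (cases "op_completed N K R a (Suc k)")
      case True
      then have "used_within N x z (q * (q ^ c * D)) (Suc k)"
        using Suc ca q \<open>0 \<le> D\<close> by (intro used_within_op_completed) auto
      then show ?thesis
        using True ca by (simp add: mult.assoc)
    next
      case False
      then show ?thesis
        using Suc ca by simp
    qed
  qed
  then show ?thesis
    using q \<open>0 \<le> D\<close> unfolding ops_def by (auto elim: used_within_mono)
qed

end

section \<open>Maximum-norm bound for the agents' iterates\<close>

lemma infnorm_le_cart:
  fixes v :: "real^'n"
  assumes "\<And>j. \<bar>v $ j\<bar> \<le> B"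
  shows "infnorm v \<le> B"
  unfolding infnorm_cart using assms by (intro cSup_least) auto

theorem theorem2:
  fixes h :: "real^'n \<Rightarrow> real"
    and g :: "real^'n \<Rightarrow> real^'m"
    and X :: "(real^'n) set"
    and Xs :: "'n \<Rightarrow> real set"
    and \<delta> \<beta> \<gamma> qp :: real
    and xbar xstar :: "real^'n"
    and \<mu>t :: "real^'m"
    and L :: "real^'n \<Rightarrow> real^'m \<Rightarrow> real"
    and H :: "real^'n \<Rightarrow> real^'m \<Rightarrow> real^'n^'n"
    and M :: "(real^'m) set"
    and N :: "'n \<Rightarrow> 'n set"
    and K :: "'n \<Rightarrow> nat set"
    and R :: "'n \<Rightarrow> 'n \<Rightarrow> nat set"
    and x :: "'n \<Rightarrow> nat \<Rightarrow> real^'n"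
  assumes "\<delta> > 0" and "\<beta> > 0"
    and L: "L = reg_lagrangian h g \<delta>"
    and H: "H = (\<lambda>y \<mu>. hess (\<lambda>z. L z \<mu>) y)"
    and A1: "twice_cont_diff h" "convex_on UNIV h"
    and A2: "xbar \<in> X" "\<forall>j. g xbar $ j < 0"
      "\<forall>j. twice_cont_diff (\<lambda>y. g y $ j)" "\<forall>j. convex_on UNIV (\<lambda>y. g y $ j)"
    and A3: "X \<noteq> {}" "compact X" "convex X" "X = {y. \<forall>i. y $ i \<in> Xs i}"
    and A4: "\<forall>i. \<forall>y\<in>X. \<forall>\<mu>. (\<forall>j. 0 \<le> \<mu> $ j) \<longrightarrow>
      \<bar>H y \<mu> $ i $ i\<bar> - \<beta> \<ge> (\<Sum>j\<in>UNIV - {i}. \<bar>H y \<mu> $ i $ j\<bar>)"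
    and M: "M = dual_set h g X xbar"
    and "\<gamma> > 0"
    and gamma: "\<gamma> < 1 / (MAX i. SUP y\<in>X. SUP \<mu>\<in>M. \<Sum>j\<in>UNIV. \<bar>H y \<mu> $ i $ j\<bar>)"
    and qp: "qp = 1 - \<gamma> * \<beta>"
    and "\<mu>t \<in> M"
    and N: "N = ess_nbrs L"
    and exec: "async_execution X Xs \<gamma> (\<lambda>y. L y \<mu>t) N K R x"
    and xstar: "xstar = (THE y. update_law X \<gamma> (\<lambda>z. L z \<mu>t) y = y)"
  shows "(\<forall>i k. \<forall>j\<in>insert i (N i).
            \<bar>(x i k - xstar) $ j\<bar>
              \<le> qp ^ ops N K R k * (MAX j. infnorm (x j 0 - xstar))) \<and>
         (\<forall>i k. (\<forall>j. j \<noteq> i \<and> j \<notin> N i \<longrightarrow> up_to_date N K R x i k j) \<longrightarrow>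
            infnorm (x i k - xstar)
              \<le> qp ^ ops N K R k * (MAX j. infnorm (x j 0 - xstar)))"
proof -
  define F where "F = (\<lambda>y. L y \<mu>t)"
  define S where "S = (MAX i. SUP y\<in>X. SUP \<mu>\<in>M. \<Sum>j\<in>UNIV. \<bar>H y \<mu> $ i $ j\<bar>)"
  define f where "f = update_law X \<gamma> F"
  define D where "D = (MAX j. infnorm (x j 0 - xstar))"
  have F: "F differentiable at y" "grad F differentiable at y" for y
    unfolding F_def L
    using differentiable_reg_lagrangian[OF A1(1) A2(3)]
      grad_differentiable_reg_lagrangian[OF A1(1) A2(3)] by auto
  have \<mu>t: "\<forall>j. 0 \<le> \<mu>t $ j"
    using \<open>\<mu>t \<in> M\<close> by (simp add: M dual_set_def)
  have "convex_on UNIV F"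
    unfolding F_def L using convex_reg_lagrangian[OF A1(1) A2(3) A1(2) A2(4) \<mu>t] .
  then have diag: "0 \<le> hess F y $ i $ i" for y i
    using F by (intro hess_diag_nonneg)
  have H_eq: "H y \<mu>t = hess F y" for y
    by (simp add: H F_def)

  obtain B where "(\<Sum>j\<in>UNIV. \<bar>H y \<mu> $ i $ j\<bar>) \<le> B" if "y \<in> X" "\<mu> \<in> M" for i y \<mu>
    using hess_reg_lagrangian_bounded[OF A1(1) A2(3) A3(2),
        of "(h xbar - (INF x\<in>X. h x)) / (MIN j. - (g xbar $ j))" \<delta>]
    unfolding H L M dual_set_def by blast
  then have S_ge: "(\<Sum>j\<in>UNIV. \<bar>hess F y $ i $ j\<bar>) \<le> S" if "y \<in> X" for i y
    unfolding S_def H_eq[symmetric]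
    by (intro row_sum_le_MAX_SUP[where s = "\<lambda>i y \<mu>. \<Sum>j\<in>UNIV. \<bar>H y \<mu> $ i $ j\<bar>"] that \<open>\<mu>t \<in> M\<close>) auto
  have diag_le: "hess F y $ i $ i \<le> S" if "y \<in> X" for y i
    using member_le_sum[of i UNIV "\<lambda>j. \<bar>hess F y $ i $ j\<bar>"] S_ge[OF that, of i] by simp
  have dom: "(\<Sum>j\<in>UNIV - {i}. \<bar>hess F y $ i $ j\<bar>) \<le> hess F y $ i $ i - \<beta>" if "y \<in> X" for y i
    using A4[rule_format, OF that \<mu>t[rule_format], of i] diag[of y i] by (simp add: H_eq)
  have \<beta>_le: "\<beta> \<le> hess F y $ i $ i" if "y \<in> X" for y i
  proof -
    have "0 \<le> (\<Sum>j\<in>UNIV - {i}. \<bar>hess F y $ i $ j\<bar>)"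
      by (simp add: sum_nonneg)
    then show ?thesis
      using dom[OF that, of i] by linarith
  qed
  \<comment> \<open>Dominance at the Slater point makes \<open>S\<close> positive, so the step-size
    condition can be multiplied out to \<open>\<gamma> * S < 1\<close>.\<close>
  have "\<beta> \<le> S"
    using \<beta>_le[OF A2(1)] diag_le[OF A2(1)] by (meson order_trans)
  then have \<gamma>S: "\<gamma> * S < 1"
    using gamma \<open>\<beta> > 0\<close> by (simp add: S_def[symmetric] field_simps)
  have row: "\<gamma> * hess F y $ i $ i \<le> 1" if "y \<in> X" for y i
    using mult_left_mono[OF diag_le[OF that, of i] less_imp_le[OF \<open>\<gamma> > 0\<close>]] \<gamma>S by linarith
  have q: "0 \<le> qp" "qp < 1"
    using mult_left_mono[OF \<open>\<beta> \<le> S\<close> less_imp_le[OF \<open>\<gamma> > 0\<close>]] \<gamma>S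
      mult_pos_pos[OF \<open>\<gamma> > 0\<close> \<open>\<beta> > 0\<close>]
    unfolding qp by linarith+

  have "closed X"
    using A3 by (simp add: compact_imp_closed)
  \<comment> \<open>As coordinate projections of \<open>X\<close>, the blocks inherit compactness
    and convexity. A point of \<open>X\<close> fills the other coordinates when a block element is
    lifted.\<close>
  have Xs_image: "Xs i = (\<lambda>y. y $ i) ` X" for i
  proof
    obtain y where y: "y \<in> X"
      using A2(1) ..
    show "Xs i \<subseteq> (\<lambda>y. y $ i) ` X"
    proof
      fix a
      assume "a \<in> Xs i"
      then have "(\<chi> l. if l = i then a else y $ l) \<in> X"
        using y A3(4) by simp
      then show "a \<in> (\<lambda>y. y $ i) ` X"
        by (rule rev_image_eqI) simp
    qed
  qed (use A3(4) in auto)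
  have Xs: "closed (Xs i)" "convex (Xs i)" "Xs i \<noteq> {}" for i
    unfolding Xs_image using A3
    by (auto intro!: compact_imp_closed compact_continuous_image continuous_intros
        convex_linear_image bounded_linear.linear[OF bounded_linear_vec_nth])
  have f_nth: "f y $ i = closest_point (Xs i) (y $ i - \<gamma> * grad F y $ i)" for y i
    unfolding f_def update_law_def
    by (simp add: closest_point_box[OF A3(4) A3(3) \<open>closed X\<close> A3(1) Xs(1)])
  \<comment> \<open>The neighbor relation ranges over all multipliers, so for a non-neighbor the
    partial derivative is independent of coordinate \<open>i\<close> at \<open>\<mu>t\<close> in
    particular.\<close>
  have zero: "hess F y $ i $ j = 0" if "j \<notin> insert i (N i)" for i j y
  proof (rule hess_eq_0_if_partial_indep[OF F])
    fix y w :: "real^'n"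
    assume "\<forall>l. l \<noteq> i \<longrightarrow> y $ l = w $ l"
    then show "grad F y $ j = grad F w $ j"
      using that by (auto simp: N ess_nbrs_def F_def)
  qed
  \<comment> \<open>Projection onto a closed convex block is nonexpansive, so the estimate for the
    unprojected step carries over.\<close>
  have contr: "\<bar>f y $ i - f w $ i\<bar> \<le> qp * B"
    if "y \<in> X" "w \<in> X" "\<And>j. j \<in> insert i (N i) \<Longrightarrow> \<bar>y $ j - w $ j\<bar> \<le> B" for y w i B
  proof -
    have "\<bar>f y $ i - f w $ i\<bar> \<le> \<bar>(y $ i - \<gamma> * grad F y $ i) - (w $ i - \<gamma> * grad F w $ i)\<bar>"
      using closest_point_lipschitz[OF Xs(2,1,3)] by (simp add: f_nth dist_real_def)
    also have "\<dots> \<le> qp * B"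
      unfolding qp
      by (rule gradient_step_contraction[where X = X and S = "insert i (N i)"])
        (use F A3 that \<open>\<gamma> > 0\<close> row dom zero in auto)
    finally show ?thesis .
  qed

  \<comment> \<open>The description defining \<open>xstar\<close> denotes a fixed point once
    existence and uniqueness are known. Existence comes from Brouwer's theorem on
    \<open>X\<close>.\<close>
  have f_in: "f y \<in> X" for y
    unfolding f_def update_law_def using \<open>closed X\<close> A3(1) by (rule closest_point_in_set)
  have "continuous_on X (grad F)"
    by (intro continuous_at_imp_continuous_on ballI differentiable_imp_continuous_within F(2))
  then have "continuous_on X (\<lambda>y. y - \<gamma> *\<^sub>R grad F y)"
    by (intro continuous_intros)
  then have "continuous_on X f"
    unfolding f_def update_law_def
    by (rule continuous_on_compose2[OF
          continuous_on_closest_point[OF A3(3) \<open>closed X\<close> A3(1), of UNIV]]) simp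
  then obtain w where w: "w \<in> X" "f w = w"
    using brouwer[OF A3(2,3,1)] f_in by (metis Pi_I)
  \<comment> \<open>Any fixed point lies in the range of \<open>f\<close>, hence in
    \<open>X\<close>, where the contraction applies. Since \<open>qp < 1\<close>, the distance to
    \<open>w\<close> must vanish.\<close>
  have unique: "y = w" if "f y = y" for y
  proof -
    have "y \<in> X"
      using f_in[of y] that by simp
    have "infnorm (y - w) \<le> qp * infnorm (y - w)"
    proof (rule infnorm_le_cart)
      fix i
      show "\<bar>(y - w) $ i\<bar> \<le> qp * infnorm (y - w)"
        using contr[OF \<open>y \<in> X\<close> w(1), of i "infnorm (y - w)"] component_le_infnorm_cart[of "y - w"]
        by (simp add: that w(2))
    qed
    then have "infnorm (y - w) \<le> 0"
      using q by (simp add: mult_le_cancel_right1)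
    then show ?thesis
      using infnorm_pos_lt[of "y - w"] by auto
  qed
  have "xstar = (THE y. f y = y)"
    by (simp only: xstar f_def F_def)
  also have "\<dots> = w"
    using w(2) unique by (rule the_equality)
  finally have star: "xstar \<in> X" "f xstar = xstar"
    using w by simp_all

  have exec: "async_execution X Xs \<gamma> F N K R x"
    using exec by (simp add: F_def)
  have D_ge: "infnorm (x i 0 - xstar) \<le> D" for i
    unfolding D_def by (rule Max_ge) auto
  then have "0 \<le> D"
    using infnorm_pos_le order_trans by blast
  have bound: "used_within N x xstar (qp ^ ops N K R k * D) k" for k
  proof (rule used_within_ops[OF exec])
    fix i k B
    assume B: "\<And>j. j \<in> insert i (N i) \<Longrightarrow> \<bar>x i k $ j - xstar $ j\<bar> \<le> B"
    have "x i k \<in> X"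
      using exec by (simp add: async_execution_def)
    \<comment> \<open>The computed entry is component \<open>i\<close> of \<open>f (x i k)\<close>,
      and \<open>xstar\<close> is its own image under \<open>f\<close>.\<close>
    then show "\<bar>closest_point (Xs i) (x i k $ i - \<gamma> * grad F (x i k) $ i) - xstar $ i\<bar> \<le> qp * B"
      using contr[OF _ star(1) B] star(2) by (simp add: f_nth[symmetric])
  next
    show "used_within N x xstar D 0"
      using component_le_infnorm_cart[of "x i 0 - xstar" j for i j] D_ge
      unfolding used_within_def by (metis order_trans vector_minus_component)
  qed (use q \<open>0 \<le> D\<close> in auto)
  have part1: "\<bar>(x i k - xstar) $ j\<bar> \<le> qp ^ ops N K R k * D" if "j \<in> insert i (N i)" for i j k
    using bound[of k] that unfolding used_within_def vector_minus_component by blast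
  moreover have "infnorm (x i k - xstar) \<le> qp ^ ops N K R k * D"
    if up: "\<forall>j. j \<noteq> i \<and> j \<notin> N i \<longrightarrow> up_to_date N K R x i k j" for i k
  proof (rule infnorm_le_cart)
    fix j
    show "\<bar>(x i k - xstar) $ j\<bar> \<le> qp ^ ops N K R k * D"
    proof (cases "j \<in> insert i (N i)")
      case True
      then show ?thesis by (rule part1)
    next
      case False
      \<comment> \<open>The entry is agent \<open>j\<close>'s own value at a time with the same
        operation count, so the bound for own entries applies with the same power of
        \<open>qp\<close>.\<close>
      then obtain s where s: "ops N K R s = ops N K R k" "x i k $ j = x j s $ j"
        using up unfolding up_to_date_def by auto
      then show ?thesis
        using part1[of j j s] by simp
    qed
  qed
  ultimately show ?thesis
    unfolding D_def by blast
qed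

end
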